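(* Let $f:\mathbb{R}^d\to[0,\infty)$ be an upper semi-continuous log-concave function with finite integral. For $z\in\mathbb{R}^d$ write $f_{[z]}(x)=f(x+z)$, $x\in\mathbb{R}^d$. Then the function $$z\mapsto \int_{\mathbb{R}^d} \mathcal{L}_\infty\bigl(f_{[z]}\bigr)$$ is convex on the interior of the support of $f$, and its reciprocal is log-concave on the interior of the support of $f$.
   Context: The support of a non-negative function $f$ on $\mathbb{R}^d$ is $\operatorname{supp} f=\{x\in\mathbb{R}^d: f(x)>0\}$. A non-negative function on $\mathbb{R}^d$ is log-concave if its logarithm is concave on its support (in particular, the support is convex). The polar (log-conjugate) of a non-negative function $f$ on $\mathbb{R}^d$ is $$\mathcal{L}_\infty f(y)=\inf_{\{x: f(x)>0\}} \frac{e^{-\langle x,y\rangle}}{f(x)}.$$ *)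

theory Defs
  imports "HOL-Analysis.Analysis"
begin

definition fun_supp :: "('a \<Rightarrow> real) \<Rightarrow> 'a set" where
  "fun_supp f = {x. 0 < f x}"

(* The restriction to the support inside S is essential: ln 0 = 0 in HOL.
   concave_on includes convexity of its domain. *)
definition log_concave_on :: "'a::real_vector set \<Rightarrow> ('a \<Rightarrow> real) \<Rightarrow> bool" where
  "log_concave_on S f \<longleftrightarrow> (\<forall>x\<in>S. 0 \<le> f x) \<and> concave_on (S \<inter> fun_supp f) (\<lambda>x. ln (f x))"

definition upper_semicontinuous :: "('a::topological_space \<Rightarrow> real) \<Rightarrow> bool" where
  "upper_semicontinuous f \<longleftrightarrow> (\<forall>x. \<forall>c > f x. \<forall>\<^sub>F y in nhds x. f y < c)"

(* Valued in [0, \<infinity>], so that the infimum over an empty support is \<infinity>. *)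
definition log_polar :: "('a::real_inner \<Rightarrow> real) \<Rightarrow> 'a \<Rightarrow> ennreal" where
  "log_polar f y = (INF x\<in>fun_supp f. ennreal (exp (- (x \<bullet> y)) / f x))"

definition translate :: "('a::plus \<Rightarrow> 'b) \<Rightarrow> 'a \<Rightarrow> 'a \<Rightarrow> 'b" where
  "translate f z = (\<lambda>x. f (x + z))"

definition polar_integral :: "('a::euclidean_space \<Rightarrow> real) \<Rightarrow> 'a \<Rightarrow> ennreal" where
  "polar_integral f z = (\<integral>\<^sup>+ y. log_polar (translate f z) y \<partial>lborel)"

end

theory Submission
  imports Defs
begin

text \<open>
  Substituting \<open>u = x + z\<close> in the infimum shows that translating a function by \<open>z\<close> multiplies
  its polar by \<open>exp (z \<bullet> y)\<close> (lemma \<open>log_polar_translate\<close>). The polar integral is therefore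
  the Laplace transform \<open>\<integral> exp (z \<bullet> y) * log_polar f y \<partial>y\<close> of one fixed non-negative
  function, and Laplace transforms are log-convex in \<open>z\<close> (lemma \<open>laplace_log_convex\<close>). Log-convexity
  of a positive function says that its reciprocal is log-concave, and it implies convexity by the
  inequality between weighted geometric and arithmetic means.

  What remains is that the Laplace transform is finite and positive at interior points of the
  support; after a translation the point is the origin. There a log-concave function is bounded
  below by some \<open>c > 0\<close> on a ball of radius \<open>\<rho>\<close>. Testing the infimum at the point of norm \<open>\<rho>\<close>
  in direction \<open>y\<close> bounds the polar by \<open>exp (- \<rho> * norm y) / c\<close>, which is
  integrable. For positivity, the polar has to be bounded below on a ball, that is, \<open>f\<close> has to
  decay exponentially (lemma \<open>log_concave_exponential_decay\<close>). By log-concavity, \<open>f \<ge> sqrt (f p * c)\<close> on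
  the ball of radius \<open>\<rho> / 2\<close> about \<open>p / 2\<close>, the midpoints between \<open>p\<close> and the first ball. The
  mass of \<open>f\<close> on that ball tends to \<open>0\<close> as \<open>p\<close> goes to infinity, because \<open>f\<close> is integrable, so
  \<open>f p\<close> does too. Once \<open>f < c / e\<close> on a sphere about the origin, concavity of the logarithm
  along rays from the origin, at which \<open>f \<ge> c\<close>, forces linear decay of \<open>ln f\<close> outside that sphere.
\<close>

section \<open>Log-concave functions and their translates\<close>

lemma log_concave_onD:
  assumes lc: "log_concave_on UNIV f" and "0 < f x" "0 < f y" "0 \<le> u" "0 \<le> v" "u + v = 1"
  shows "exp (u * ln (f x) + v * ln (f y)) \<le> f (u *\<^sub>R x + v *\<^sub>R y)"
proof -
  have cc: "concave_on (fun_supp f) (\<lambda>x. ln (f x))"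
    using lc by (simp add: log_concave_on_def)
  have mem: "x \<in> fun_supp f" "y \<in> fun_supp f" using assms by (auto simp: fun_supp_def)
  have le: "u * ln (f x) + v * ln (f y) \<le> ln (f (u *\<^sub>R x + v *\<^sub>R y))"
    using cc mem assms(4-6) unfolding concave_on_iff by blast
  have "convex (fun_supp f)" using cc by (simp add: concave_on_iff)
  then have "u *\<^sub>R x + v *\<^sub>R y \<in> fun_supp f"
    using mem assms(4-6) by (simp add: convex_def)
  then have "0 < f (u *\<^sub>R x + v *\<^sub>R y)" by (simp add: fun_supp_def)
  with le show ?thesis by (metis exp_le_cancel_iff exp_ln)
qed

lemma fun_supp_translate:
  fixes f :: "'a::real_vector \<Rightarrow> real"
  shows "fun_supp (translate f z) = (\<lambda>u. u - z) ` fun_supp f"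
proof -
  have "x \<in> (\<lambda>u. u - z) ` fun_supp f" if "0 < f (x + z)" for x
    using that by (intro image_eqI[of _ _ "x + z"]) (auto simp: fun_supp_def algebra_simps)
  then show ?thesis by (auto simp: fun_supp_def translate_def)
qed

lemma log_concave_on_translate:
  fixes f :: "'a::real_vector \<Rightarrow> real"
  assumes "log_concave_on UNIV f"
  shows "log_concave_on UNIV (translate f z)"
  unfolding log_concave_on_def
proof (intro conjI ballI)
  have lc: "\<And>x. 0 \<le> f x" and cc: "concave_on (fun_supp f) (\<lambda>x. ln (f x))"
    using assms by (auto simp: log_concave_on_def)
  show "0 \<le> translate f z x" for x using lc by (simp add: translate_def)
  have comb: "u *\<^sub>R x + v *\<^sub>R y + z = u *\<^sub>R (x + z) + v *\<^sub>R (y + z)" if "u + v = 1" for u v x y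
  proof -
    have "u *\<^sub>R z + v *\<^sub>R z = z" using that by (metis scaleR_left_distrib scaleR_one)
    then show ?thesis by (simp add: algebra_simps)
  qed
  have "convex (fun_supp (translate f z))"
    unfolding fun_supp_translate using cc by (simp add: convex_translation_subtract concave_on_iff)
  then show "concave_on (UNIV \<inter> fun_supp (translate f z)) (\<lambda>x. ln (translate f z x))"
    using cc by (auto simp: concave_on_iff fun_supp_def translate_def comb)
qed

lemma zero_in_interior_translate:
  assumes "z \<in> interior (fun_supp (f :: 'a::real_normed_vector \<Rightarrow> real))"
  shows "0 \<in> interior (fun_supp (translate f z))"
proof -
  have "(\<lambda>u. u - z) ` interior (fun_supp f) = interior (fun_supp (translate f z))"
    unfolding fun_supp_translate by (simp add: interior_translation_subtract)
  moreover have "0 \<in> (\<lambda>u. u - z) ` interior (fun_supp f)"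
    using assms by (intro image_eqI[of _ _ z]) auto
  ultimately show ?thesis by simp
qed

lemma integrable_translate:
  fixes f :: "'a::euclidean_space \<Rightarrow> real"
  assumes "integrable lborel f"
  shows "integrable lborel (translate f z)"
proof -
  have "integrable (distr lborel borel ((+) z)) f"
    using assms by (simp add: lborel_distr_plus)
  then have "integrable lborel (\<lambda>x. f (z + x))"
    using assms by (subst (asm) integrable_distr_eq) auto
  then show ?thesis by (simp add: translate_def add.commute)
qed

section \<open>The polar integral as a Laplace transform\<close>

lemma log_polar_translate:
  fixes f :: "'a::real_inner \<Rightarrow> real"
  shows "log_polar (translate f z) y = ennreal (exp (z \<bullet> y)) * log_polar f y"
proof -
  let ?c = "ennreal (exp (z \<bullet> y))"
  let ?g = "\<lambda>u. ennreal (exp (- (u \<bullet> y)) / f u)"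
  \<comment> \<open>An order isomorphism commutes with arbitrary infima, the empty one (which is \<open>\<infinity>\<close>) included.\<close>
  have bij: "bij (\<lambda>a. ?c * a)"
  proof (rule o_bij)
    show "(\<lambda>a. ennreal (exp (- (z \<bullet> y))) * a) \<circ> (\<lambda>a. ?c * a) = id"
      by (rule ext) (simp add: mult.assoc[symmetric] ennreal_mult[symmetric] exp_minus)
    show "(\<lambda>a. ?c * a) \<circ> (\<lambda>a. ennreal (exp (- (z \<bullet> y))) * a) = id"
      by (rule ext) (simp add: mult.assoc[symmetric] ennreal_mult[symmetric] exp_minus)
  qed
  have "log_polar (translate f z) y = (INF u\<in>fun_supp f. ?c * ?g u)"
    unfolding log_polar_def fun_supp_translate image_image
    by (intro INF_cong refl)
       (auto simp: fun_supp_def translate_def ennreal_mult[symmetric] inner_diff_left exp_diff exp_minus field_simps)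
  also have "\<dots> = ?c * (INF u\<in>fun_supp f. ?g u)"
    using mono_bij_Inf[OF _ bij, of "?g ` fun_supp f"]
    by (simp add: mono_def mult_left_mono image_image)
  finally show ?thesis by (simp add: log_polar_def)
qed

text \<open>The support is in general uncountable, so measurability of the infimum comes from upper
  semicontinuity: a sublevel set of an infimum of continuous functions is a union of open sets.\<close>
lemma borel_measurable_log_polar: "log_polar f \<in> borel_measurable borel"
proof (rule borel_measurableI_less)
  fix c
  have "open {y. ennreal (exp (- (x \<bullet> y)) * (1 / f x)) < c}" for x
    by (intro open_Collect_less continuous_on_ennreal continuous_intros)
  then have "open {y. ennreal (exp (- (x \<bullet> y)) / f x) < c}" for x
    by simp
  moreover have "{y. log_polar f y < c} = (\<Union>x\<in>fun_supp f. {y. ennreal (exp (- (x \<bullet> y)) / f x) < c})"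
    by (auto simp: log_polar_def INF_less_iff)
  ultimately show "{y \<in> space borel. log_polar f y < c} \<in> sets borel" by (auto intro!: borel_open)
qed

lemma polar_integral_laplace:
  fixes f :: "'a::euclidean_space \<Rightarrow> real"
  shows "polar_integral f z = (\<integral>\<^sup>+ y. ennreal (exp (z \<bullet> y)) * log_polar f y \<partial>lborel)"
  by (simp add: polar_integral_def log_polar_translate)

text \<open>This is Hoelder's inequality for the exponents \<open>1 / u\<close> and \<open>1 / v\<close>. It is obtained by
  normalising both exponentials to have integral \<open>1\<close> against \<open>g\<close> and integrating the pointwise
  convexity inequality of \<open>exp\<close>.\<close>
lemma laplace_log_convex:
  fixes g :: "'a::euclidean_space \<Rightarrow> ennreal"
  defines "P \<equiv> \<lambda>z. \<integral>\<^sup>+ y. ennreal (exp (z \<bullet> y)) * g y \<partial>lborel"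
  assumes g: "g \<in> borel_measurable borel"
    and P: "P a = ennreal p" "P b = ennreal q" and pos: "0 < p" "0 < q"
    and uv: "0 \<le> u" "0 \<le> v" "u + v = 1"
  shows "P (u *\<^sub>R a + v *\<^sub>R b) \<le> ennreal (exp (u * ln p + v * ln q))"
proof -
  note [measurable] = g
  let ?m = "exp (u * ln p + v * ln q)"
  have young: "exp ((u *\<^sub>R a + v *\<^sub>R b) \<bullet> y) \<le> ?m * u / p * exp (a \<bullet> y) + ?m * v / q * exp (b \<bullet> y)" for y
  proof -
    have "exp (u * (a \<bullet> y - ln p) + v * (b \<bullet> y - ln q))
        \<le> u * exp (a \<bullet> y - ln p) + v * exp (b \<bullet> y - ln q)"
      using exp_convex uv unfolding convex_on_def by simp
    then have "?m * exp (u * (a \<bullet> y - ln p) + v * (b \<bullet> y - ln q))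
        \<le> ?m * (u * exp (a \<bullet> y - ln p) + v * exp (b \<bullet> y - ln q))"
      by simp
    moreover have "?m * exp (u * (a \<bullet> y - ln p) + v * (b \<bullet> y - ln q)) = exp ((u *\<^sub>R a + v *\<^sub>R b) \<bullet> y)"
      by (simp add: exp_add[symmetric] inner_add_left algebra_simps)
    ultimately show ?thesis using pos by (simp add: exp_diff field_simps)
  qed
  have "P (u *\<^sub>R a + v *\<^sub>R b)
      \<le> (\<integral>\<^sup>+ y. ennreal (?m * u / p) * (ennreal (exp (a \<bullet> y)) * g y)
             + ennreal (?m * v / q) * (ennreal (exp (b \<bullet> y)) * g y) \<partial>lborel)"
    unfolding P_def
  proof (rule nn_integral_mono)
    fix y
    have "ennreal (exp ((u *\<^sub>R a + v *\<^sub>R b) \<bullet> y))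
        \<le> ennreal (?m * u / p) * ennreal (exp (a \<bullet> y)) + ennreal (?m * v / q) * ennreal (exp (b \<bullet> y))"
      using young[of y] uv pos by (simp add: ennreal_mult[symmetric] ennreal_plus[symmetric] ennreal_leI del: ennreal_plus)
    then show "ennreal (exp ((u *\<^sub>R a + v *\<^sub>R b) \<bullet> y)) * g y
      \<le> ennreal (?m * u / p) * (ennreal (exp (a \<bullet> y)) * g y) + ennreal (?m * v / q) * (ennreal (exp (b \<bullet> y)) * g y)"
      by (metis distrib_right mult.assoc mult_right_mono zero_le)
  qed
  also have "\<dots> = ennreal (?m * u / p) * P a + ennreal (?m * v / q) * P b"
    unfolding P_def by (subst nn_integral_add) (auto simp: nn_integral_cmult)
  also have "\<dots> = ennreal (?m * u / p * p + ?m * v / q * q)"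
    using uv pos by (simp add: P ennreal_mult[symmetric] ennreal_plus[symmetric] del: ennreal_plus)
  also have "?m * u / p * p + ?m * v / q * q = ?m"
    using pos uv(3) by (simp add: distrib_left[symmetric])
  finally show ?thesis .
qed

section \<open>Finiteness of the polar integral\<close>

text \<open>A finite concave function on an open set is continuous, so \<open>ln f\<close> attains a minimum on a
  compact ball inside the support.\<close>
lemma log_concave_lower_bound:
  fixes f :: "'a::euclidean_space \<Rightarrow> real"
  assumes lc: "log_concave_on UNIV f" and int: "0 \<in> interior (fun_supp f)"
  obtains \<rho> c where "0 < \<rho>" "0 < c" "\<And>x. norm x \<le> \<rho> \<Longrightarrow> c \<le> f x"
proof -
  let ?S = "interior (fun_supp f)"
  obtain \<rho> where \<rho>: "0 < \<rho>" "cball 0 \<rho> \<subseteq> ?S"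
    using int open_contains_cball[of ?S] by auto
  have cc: "concave_on (fun_supp f) (\<lambda>x. ln (f x))" using lc by (simp add: log_concave_on_def)
  then have "convex ?S" by (simp add: concave_on_iff convex_interior)
  then have "convex_on ?S (\<lambda>x. - ln (f x))"
    using cc unfolding concave_on_def by (meson convex_on_subset interior_subset)
  then have "continuous_on ?S (\<lambda>x. - ln (f x))"
    by (intro convex_on_continuous) auto
  then have "continuous_on (cball 0 \<rho>) (\<lambda>x. - ln (f x))"
    using \<rho> continuous_on_subset by blast
  then obtain x0 where x0: "x0 \<in> cball 0 \<rho>" "\<forall>x\<in>cball 0 \<rho>. - ln (f x) \<le> - ln (f x0)"
    using \<rho>(1) by (metis continuous_attains_sup compact_cball cball_eq_empty not_less_iff_gr_or_eq)
  have pos: "0 < f x" if "x \<in> cball 0 \<rho>" for x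
    using that \<rho> interior_subset[of "fun_supp f"] by (auto simp: fun_supp_def)
  have "f x0 \<le> f x" if "norm x \<le> \<rho>" for x
  proof -
    have x: "x \<in> cball 0 \<rho>" using that by simp
    then have "ln (f x0) \<le> ln (f x)" using x0(2) by force
    then show ?thesis using pos[OF x] pos[OF x0(1)] by simp
  qed
  then show ?thesis using that[of \<rho> "f x0"] \<rho>(1) pos[OF x0(1)] by blast
qed

lemma exp_abs_integral_finite:
  fixes a :: real
  assumes "0 < a"
  shows "(\<integral>\<^sup>+ t. ennreal (exp (- (a * \<bar>t\<bar>))) \<partial>lborel) < \<infinity>"
proof -
  let ?h = "\<lambda>t. ennreal (exp (- (a * t))) * indicator {0..} t"
  have lim: "((\<lambda>t. - exp (- (a * t)) / a) \<longlongrightarrow> 0) at_top"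
  proof -
    have "filterlim (\<lambda>t. a * t) at_top at_top"
      using assms by (intro filterlim_tendsto_pos_mult_at_top[OF tendsto_const] filterlim_ident)
    then have "filterlim (\<lambda>t. - (a * t)) at_bot at_top"
      by (simp add: filterlim_uminus_at_bot)
    then have "((\<lambda>t. exp (- (a * t))) \<longlongrightarrow> 0) at_top"
      by (rule filterlim_compose[OF exp_at_bot])
    from tendsto_divide[OF tendsto_minus[OF this] tendsto_const[of a]] assms show ?thesis by simp
  qed
  have half: "(\<integral>\<^sup>+ t. ?h t \<partial>lborel) = ennreal (0 - (- exp (- (a * 0)) / a))"
    using assms
    by (intro nn_integral_FTC_atLeast[OF _ _ _ lim]) (auto intro!: derivative_eq_intros)
  have "(\<integral>\<^sup>+ t. ?h (- t) \<partial>lborel) = (\<integral>\<^sup>+ t. ?h t \<partial>lborel)"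
    using nn_integral_real_affine[of ?h "-1" 0] by simp
  moreover have "(\<integral>\<^sup>+ t. ennreal (exp (- (a * \<bar>t\<bar>))) \<partial>lborel) \<le> (\<integral>\<^sup>+ t. ?h t + ?h (- t) \<partial>lborel)"
    by (intro nn_integral_mono) (auto simp: indicator_def abs_if)
  moreover have "(\<integral>\<^sup>+ t. ?h t + ?h (- t) \<partial>lborel) = (\<integral>\<^sup>+ t. ?h t \<partial>lborel) + (\<integral>\<^sup>+ t. ?h (- t) \<partial>lborel)"
    by (rule nn_integral_add) auto
  ultimately show ?thesis using half by (simp add: le_less_trans)
qed

text \<open>Each coordinate is at most the norm, so the norm dominates the average of the absolute
  coordinates; this reduces the integral to a product of one-dimensional ones.\<close>
lemma exp_norm_integral_finite:
  assumes "0 < r"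
  shows "(\<integral>\<^sup>+ y. ennreal (exp (- (r * norm y))) \<partial>(lborel :: 'a::euclidean_space measure)) < \<infinity>"
proof -
  let ?a = "r / DIM('a)"
  have pos: "0 < ?a" using assms by simp
  have "(\<integral>\<^sup>+ y. ennreal (exp (- (r * norm y))) \<partial>(lborel :: 'a measure))
     \<le> (\<integral>\<^sup>+ y. (\<Prod>b\<in>Basis. ennreal (exp (- (?a * \<bar>y \<bullet> b\<bar>)))) \<partial>(lborel :: 'a measure))"
  proof (rule nn_integral_mono)
    fix y :: 'a
    have "(\<Sum>b\<in>Basis. \<bar>y \<bullet> b\<bar>) \<le> real DIM('a) * norm y"
      using sum_bounded_above[of Basis "\<lambda>b. \<bar>y \<bullet> b\<bar>" "norm y"] Basis_le_norm by auto
    then have "?a * (\<Sum>b\<in>Basis. \<bar>y \<bullet> b\<bar>) \<le> ?a * (real DIM('a) * norm y)"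
      using pos mult_left_mono less_imp_le by blast
    also have "\<dots> = r * norm y" by simp
    finally have "(\<Sum>b\<in>Basis. ?a * \<bar>y \<bullet> b\<bar>) \<le> r * norm y"
      by (simp only: sum_distrib_left)
    then show "ennreal (exp (- (r * norm y))) \<le> (\<Prod>b\<in>Basis. ennreal (exp (- (?a * \<bar>y \<bullet> b\<bar>))))"
      by (simp add: prod_ennreal exp_sum[symmetric] sum_negf ennreal_leI)
  qed
  also have "\<dots> = (\<Prod>b\<in>(Basis :: 'a set). \<integral>\<^sup>+ t. ennreal (exp (- (?a * \<bar>t\<bar>))) \<partial>lborel)"
    by (rule nn_integral_lborel_prod) auto
  also have "\<dots> < \<infinity>"
    using exp_abs_integral_finite[OF pos] by (simp add: power_less_top_ennreal)
  finally show ?thesis .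
qed

lemma log_polar_integral_finite:
  fixes f :: "'a::euclidean_space \<Rightarrow> real"
  assumes "0 < \<rho>" "0 < c" and lower: "\<And>x. norm x \<le> \<rho> \<Longrightarrow> c \<le> f x"
  shows "(\<integral>\<^sup>+ y. log_polar f y \<partial>lborel) < \<infinity>"
proof -
  have "log_polar f y \<le> ennreal (1 / c) * ennreal (exp (- (\<rho> * norm y)))" for y
  proof -
    \<comment> \<open>For \<open>y = 0\<close> this is the origin, which serves as well.\<close>
    define x where "x = (\<rho> / norm y) *\<^sub>R y"
    have "norm x \<le> \<rho>" using assms by (simp add: x_def)
    then have fx: "c \<le> f x" by (rule lower)
    then have "x \<in> fun_supp f" using assms by (simp add: fun_supp_def)
    have xy: "x \<bullet> y = \<rho> * norm y"
      by (simp add: x_def power2_norm_eq_inner[symmetric] power2_eq_square)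
    have "log_polar f y \<le> ennreal (exp (- (x \<bullet> y)) / f x)"
      unfolding log_polar_def by (rule INF_lower) fact
    also have "\<dots> \<le> ennreal (exp (- (\<rho> * norm y)) / c)"
      unfolding xy using fx assms by (intro ennreal_leI frac_le) auto
    also have "\<dots> = ennreal (1 / c) * ennreal (exp (- (\<rho> * norm y)))"
      using assms by (simp add: ennreal_mult[symmetric])
    finally show ?thesis .
  qed
  then have "(\<integral>\<^sup>+ y. log_polar f y \<partial>lborel)
      \<le> (\<integral>\<^sup>+ y. ennreal (1 / c) * ennreal (exp (- (\<rho> * norm y))) \<partial>(lborel :: 'a measure))"
    by (intro nn_integral_mono)
  also have "\<dots> = ennreal (1 / c) * (\<integral>\<^sup>+ y. ennreal (exp (- (\<rho> * norm y))) \<partial>(lborel :: 'a measure))"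
    by (rule nn_integral_cmult) auto
  also have "\<dots> < \<infinity>"
    using exp_norm_integral_finite[OF \<open>0 < \<rho>\<close>, where 'a='a] by (simp add: ennreal_mult_less_top)
  finally show ?thesis .
qed

section \<open>Exponential decay and positivity of the polar integral\<close>

text \<open>The ball of radius \<open>\<rho> / 2\<close> about \<open>p / 2\<close> consists of midpoints between \<open>p\<close> and points where
  \<open>f \<ge> c\<close>. So a single large value of \<open>f\<close>, or a value at a distant point that is not small,
  forces a definite mass near \<open>p / 2\<close>. The region \<open>B\<close> is arbitrary because the estimate is needed
  both for the whole space, to bound \<open>f\<close>, and for the complement of a large ball.\<close>
lemma half_ball_mass:
  fixes f :: "'a::euclidean_space \<Rightarrow> real"
  assumes lc: "log_concave_on UNIV f" and int: "integrable lborel f"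
    and c: "0 < c" "\<And>x. norm x \<le> \<rho> \<Longrightarrow> c \<le> f x" and p: "0 < f p"
    and B: "ball (p /\<^sub>R 2) (\<rho> / 2) \<subseteq> B" "B \<in> sets borel"
  shows "sqrt (f p * c) * measure lborel (ball (0::'a) (\<rho> / 2)) \<le> (\<integral>x. indicator B x * f x \<partial>lborel)"
proof -
  let ?H = "ball (p /\<^sub>R 2) (\<rho> / 2)"
  have nonneg: "0 \<le> f x" for x using lc by (simp add: log_concave_on_def)
  have low: "sqrt (f p * c) \<le> f x" if "x \<in> ?H" for x
  proof -
    \<comment> \<open>the reflection of \<open>p\<close> in \<open>x\<close>\<close>
    define w where "w = 2 *\<^sub>R x - p"
    have "norm (2 *\<^sub>R (x - p /\<^sub>R 2)) \<le> \<rho>" using that by (simp add: dist_norm norm_minus_commute)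
    then have "norm w \<le> \<rho>" by (simp add: w_def scaleR_right_diff_distrib)
    then have w: "c \<le> f w" by (rule c)
    have x: "x = (1/2) *\<^sub>R p + (1/2) *\<^sub>R w" by (simp add: w_def scaleR_right_diff_distrib)
    have "sqrt (f p * c) = exp (ln (sqrt (f p * c)))" using p c by simp
    also have "ln (sqrt (f p * c)) = (1/2) * ln (f p) + (1/2) * ln c"
      using p c by (simp add: ln_sqrt ln_mult)
    also have "exp \<dots> \<le> exp ((1/2) * ln (f p) + (1/2) * ln (f w))" using w c by simp
    also have "\<dots> \<le> f x"
      unfolding x using w c p by (intro log_concave_onD[OF lc]) auto
    finally show ?thesis .
  qed
  have "sqrt (f p * c) * measure lborel (ball (0::'a) (\<rho> / 2)) = sqrt (f p * c) * measure lborel ?H"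
    by (metis content_ball less_eq_real_def linorder_not_less ball_empty)
  also have "\<dots> = (\<integral>x. indicator ?H x * sqrt (f p * c) \<partial>lborel)" by simp
  also have "\<dots> \<le> (\<integral>x. indicator B x * f x \<partial>lborel)"
  proof (rule integral_mono)
    show "integrable lborel (\<lambda>x. indicator ?H x * sqrt (f p * c))"
      by (intro integrable_mult_left integrable_real_indicator) (use emeasure_lborel_ball_finite in auto)
    show "integrable lborel (\<lambda>x. indicator B x * f x)"
      using integrable_mult_indicator[of B lborel f] int B(2) by simp
    show "indicator ?H x * sqrt (f p * c) \<le> indicator B x * f x" for x
      using low[of x] B(1) nonneg[of x] by (auto simp: indicator_def)
  qed
  finally show ?thesis .
qed

lemma tail_integral_tendsto_0:
  fixes f :: "'a::euclidean_space \<Rightarrow> real"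
  assumes "integrable lborel f"
  shows "(\<lambda>n. \<integral>x. indicator {x. real n \<le> norm x} x * f x \<partial>lborel) \<longlonglongrightarrow> 0"
proof -
  note [measurable] = borel_measurable_integrable[OF assms]
  have "(\<lambda>n. \<integral>x. indicator {x. real n \<le> norm x} x * f x \<partial>lborel) \<longlonglongrightarrow> (\<integral>x. 0 \<partial>(lborel :: 'a measure))"
  proof (rule integral_dominated_convergence[where w = "\<lambda>x. norm (f x)"])
    show "AE x in lborel. (\<lambda>n. indicator {x. real n \<le> norm x} x * f x) \<longlonglongrightarrow> 0"
    proof (rule AE_I2)
      fix x :: 'a
      have "\<forall>\<^sub>F n in sequentially. norm x < real n"
        using reals_Archimedean2[of "norm x"] by (metis eventually_at_top_linorder less_le_trans of_nat_le_iff)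
      then have "\<forall>\<^sub>F n in sequentially. indicator {x. real n \<le> norm x} x * f x = 0"
        by eventually_elim (simp add: indicator_def)
      then show "(\<lambda>n. indicator {x. real n \<le> norm x} x * f x) \<longlonglongrightarrow> 0"
        by (rule tendsto_eventually)
    qed
  qed (use assms in \<open>auto simp: indicator_def\<close>)
  then show ?thesis by simp
qed

text \<open>The constants come from three regimes: \<open>f\<close> is bounded globally by the total mass, it is below
  \<open>c / e\<close> at distance at least \<open>R\<close> by the tail mass, and then it decays by one factor \<open>e\<close> per
  length \<open>R\<close>, because on the ray from the origin \<open>ln f\<close> has dropped by at least \<open>1\<close> between
  norm \<open>0\<close> and norm \<open>R\<close>.\<close>
lemma log_concave_exponential_decay:
  fixes f :: "'a::euclidean_space \<Rightarrow> real"
  assumes lc: "log_concave_on UNIV f" and int: "integrable lborel f"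
    and interior: "0 \<in> interior (fun_supp f)"
  obtains A R where "0 < A" "0 < R" "\<And>x. f x \<le> A * exp (- (norm x / R))"
proof -
  obtain \<rho> c where \<rho>: "0 < \<rho>" and c: "0 < c" "\<And>x. norm x \<le> \<rho> \<Longrightarrow> c \<le> f x"
    using log_concave_lower_bound[OF lc interior] by metis
  define V where "V = measure lborel (ball (0::'a) (\<rho> / 2))"
  have V: "0 < V" using \<rho> by (simp add: V_def content_ball_pos)
  have mass: "sqrt (f p * c) * V \<le> (\<integral>x. indicator B x * f x \<partial>lborel)"
    if "0 < f p" "ball (p /\<^sub>R 2) (\<rho> / 2) \<subseteq> B" "B \<in> sets borel" for p B
    unfolding V_def using c that by (intro half_ball_mass[OF lc int]) auto
  define I where "I = (\<integral>x. f x \<partial>lborel)"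
  have bounded: "f p \<le> (I / V)\<^sup>2 / c" if p: "0 < f p" for p
  proof -
    have "sqrt (f p * c) * V \<le> I"
      using mass[OF p, of UNIV] by (simp add: I_def)
    then have "sqrt (f p * c) \<le> I / V" using V by (simp add: field_simps)
    then have "(sqrt (f p * c))\<^sup>2 \<le> (I / V)\<^sup>2" using p c by (intro power_mono) auto
    then have "f p * c \<le> (I / V)\<^sup>2" using p c by simp
    then show ?thesis using c by (simp add: pos_le_divide_eq)
  qed
  have "\<forall>\<^sub>F n in sequentially.
      (\<integral>x. indicator {x. real n \<le> norm x} x * f x \<partial>lborel) < c * exp (- 1 / 2) * V"
    using c V by (intro order_tendstoD[OF tail_integral_tendsto_0[OF int]]) auto
  then obtain n :: nat
    where n: "(\<integral>x. indicator {x. real n \<le> norm x} x * f x \<partial>lborel) < c * exp (- 1 / 2) * V"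
    by (auto simp: eventually_sequentially)
  \<comment> \<open>With this radius the ball about \<open>p / 2\<close> stays outside the ball of radius \<open>n\<close>.\<close>
  define R where "R = 2 * real n + \<rho>"
  have R: "0 < R" using \<rho> by (simp add: R_def)
  have far: "f p < c * exp (- 1)" if p: "0 < f p" "R \<le> norm p" for p
  proof -
    have "real n \<le> norm x" if "x \<in> ball (p /\<^sub>R 2) (\<rho> / 2)" for x
    proof -
      have "norm (p /\<^sub>R 2) - norm x \<le> norm (p /\<^sub>R 2 - x)" by (rule norm_triangle_ineq2)
      with that p(2) show ?thesis by (simp add: dist_norm R_def)
    qed
    then have "sqrt (f p * c) * V \<le> (\<integral>x. indicator {x. real n \<le> norm x} x * f x \<partial>lborel)"
      using p(1) by (intro mass) auto
    then have "sqrt (f p * c) < c * exp (- 1 / 2)" using n V by (smt (verit) mult_right_less_imp_less)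
    then have "(sqrt (f p * c))\<^sup>2 < (c * exp (- 1 / 2))\<^sup>2" using p c by (intro power_strict_mono) auto
    moreover have "(exp (- 1 / 2 :: real))\<^sup>2 = exp (- 1)" by (simp add: exp_double[symmetric])
    ultimately have "f p * c < c\<^sup>2 * exp (- 1)" using p c by (simp add: power_mult_distrib)
    then have "f p * c < (c * exp (- 1)) * c" by (simp add: power2_eq_square algebra_simps)
    then show ?thesis using c(1) by (metis mult_less_cancel_right_pos)
  qed
  have decay: "f x \<le> c * exp (- (norm x / R))" if x: "0 < f x" "R \<le> norm x" for x
  proof -
    define t where "t = R / norm x"
    have "0 < norm x" using R x by linarith
    then have t: "0 < t" "t \<le> 1" using R x by (simp_all add: t_def)
    have f0: "c \<le> f 0" using c \<rho> by simp
    have "exp (t * ln (f x) + (1 - t) * ln c) \<le> exp (t * ln (f x) + (1 - t) * ln (f 0))"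
      using f0 c t by (simp add: mult_left_mono)
    also have "\<dots> \<le> f (t *\<^sub>R x + (1 - t) *\<^sub>R 0)"
      using t x f0 c by (intro log_concave_onD[OF lc]) auto
    finally have low: "exp (t * ln (f x) + (1 - t) * ln c) \<le> f (t *\<^sub>R x)" by simp
    have "norm (t *\<^sub>R x) = R" using R \<open>0 < norm x\<close> by (simp add: t_def)
    moreover have "0 < f (t *\<^sub>R x)" using low by (metis exp_gt_zero less_le_trans)
    ultimately have "f (t *\<^sub>R x) < c * exp (- 1)" by (intro far) auto
    also have "\<dots> = exp (ln c - 1)" using c by (simp add: exp_diff exp_minus field_simps)
    finally have "t * ln (f x) + (1 - t) * ln c \<le> ln c - 1"
      using low by (smt (verit) exp_less_cancel_iff)
    then have "t * ln (f x) \<le> t * (ln c - 1 / t)" using t by (simp add: algebra_simps)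
    then have "ln (f x) \<le> ln c - 1 / t" using t(1) by (simp only: mult_le_cancel_left_pos)
    then have "ln (f x) \<le> ln c - norm x / R" by (simp add: t_def)
    then have "exp (ln (f x)) \<le> exp (ln c - norm x / R)" by simp
    then show ?thesis using x c by (simp add: exp_diff exp_minus field_simps)
  qed
  \<comment> \<open>The factor \<open>e\<close> compensates \<open>exp (- (norm x / R)) \<ge> 1 / e\<close> on the ball of radius \<open>R\<close>.\<close>
  define A where "A = c + (I / V)\<^sup>2 / c * exp 1"
  have nn: "0 \<le> (I / V)\<^sup>2 / c * exp 1" using c by simp
  have A: "0 < A" unfolding A_def using nn c(1) by linarith
  have "f x \<le> A * exp (- (norm x / R))" for x
  proof (cases "0 < f x")
    case False
    have "0 \<le> A * exp (- (norm x / R))" using A by simp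
    with False show ?thesis by linarith
  next
    case True
    show ?thesis
    proof (cases "R \<le> norm x")
      case far: True
      have "c * exp (- (norm x / R)) \<le> A * exp (- (norm x / R))"
        using nn by (intro mult_right_mono) (auto simp: A_def)
      with decay[OF True far] show ?thesis by linarith
    next
      case False
      then have "norm x / R \<le> 1" using R by simp
      then have "1 \<le> exp 1 * exp (- (norm x / R))" by (simp add: exp_add[symmetric])
      then have "(I / V)\<^sup>2 / c * 1 \<le> (I / V)\<^sup>2 / c * (exp 1 * exp (- (norm x / R)))"
        using c by (intro mult_left_mono) auto
      also have "\<dots> \<le> A * exp (- (norm x / R))"
        using c by (simp add: A_def algebra_simps)
      finally show ?thesis using bounded[OF True] by simp
    qed
  qed
  then show ?thesis using that A R by blast
qed

text \<open>Decay at rate \<open>1 / R\<close> absorbs \<open>exp (x \<bullet> y)\<close> as long as \<open>norm y < 1 / R\<close>, so the polar is at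
  least \<open>1 / A\<close> on a ball.\<close>
lemma log_polar_integral_pos:
  fixes f :: "'a::euclidean_space \<Rightarrow> real"
  assumes "0 < A" "0 < R" and upper: "\<And>x. f x \<le> A * exp (- (norm x / R))"
  shows "0 < (\<integral>\<^sup>+ y. log_polar f y \<partial>lborel)"
proof -
  let ?B = "ball (0::'a) (1 / R)"
  have low: "ennreal (1 / A) \<le> log_polar f y" if y: "y \<in> ?B" for y
    unfolding log_polar_def
  proof (intro INF_greatest ennreal_leI)
    fix x assume "x \<in> fun_supp f"
    then have x: "0 < f x" by (simp add: fun_supp_def)
    have "x \<bullet> y \<le> norm x * norm y" by (rule norm_cauchy_schwarz)
    also have "\<dots> \<le> norm x * (1 / R)" using y by (intro mult_left_mono) auto
    finally have xy: "exp (- (norm x / R)) \<le> exp (- (x \<bullet> y))" by simp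
    have "f x \<le> A * exp (- (x \<bullet> y))"
      using upper[of x] mult_left_mono[OF xy, of A] assms(1) by linarith
    then show "1 / A \<le> exp (- (x \<bullet> y)) / f x"
      using x assms(1) by (simp add: field_simps)
  qed
  have "emeasure lborel ?B = ennreal (measure lborel ?B)"
    using emeasure_lborel_ball_finite[of "0::'a" "1 / R"] by (intro emeasure_eq_ennreal_measure) simp
  then have "0 < ennreal (1 / A) * emeasure lborel ?B"
    using assms content_ball_pos[of "1 / R" 0] by (simp add: ennreal_zero_less_mult_iff)
  also have "\<dots> = (\<integral>\<^sup>+ y. ennreal (1 / A) * indicator ?B y \<partial>lborel)"
    by (simp add: nn_integral_cmult_indicator)
  also have "\<dots> \<le> (\<integral>\<^sup>+ y. log_polar f y \<partial>lborel)"
    using low by (intro nn_integral_mono) (auto simp: indicator_def)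
  finally show ?thesis .
qed

lemma polar_integral_pos_finite:
  fixes f :: "'a::euclidean_space \<Rightarrow> real"
  assumes lc: "log_concave_on UNIV f" and int: "integrable lborel f"
    and z: "z \<in> interior (fun_supp f)"
  shows "0 < polar_integral f z" "polar_integral f z < \<infinity>"
proof -
  let ?g = "translate f z"
  have g: "log_concave_on UNIV ?g" "integrable lborel ?g" "0 \<in> interior (fun_supp ?g)"
    using log_concave_on_translate[OF lc] integrable_translate[OF int] zero_in_interior_translate[OF z]
    by auto
  show "0 < polar_integral f z"
    unfolding polar_integral_def
    by (rule log_concave_exponential_decay[OF g]) (rule log_polar_integral_pos)
  show "polar_integral f z < \<infinity>"
    unfolding polar_integral_def
    by (rule log_concave_lower_bound[OF g(1,3)]) (rule log_polar_integral_finite)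
qed

section \<open>Convexity of the polar integral\<close>

theorem theorem2:
  fixes f :: "'a::euclidean_space \<Rightarrow> real"
  assumes nonneg: "\<And>x. 0 \<le> f x"
    and usc: "upper_semicontinuous f"
    and log_concave: "log_concave_on UNIV f"
    and finite_integral: "integrable lborel f"
  shows "(\<forall>z\<in>interior (fun_supp f). 0 < polar_integral f z \<and> polar_integral f z < \<infinity>)
    \<and> convex_on (interior (fun_supp f)) (\<lambda>z. enn2real (polar_integral f z))
    \<and> log_concave_on (interior (fun_supp f)) (\<lambda>z. 1 / enn2real (polar_integral f z))"
proof -
  let ?S = "interior (fun_supp f)" and ?p = "\<lambda>z. enn2real (polar_integral f z)"
  have conv: "convex ?S"
    using log_concave by (simp add: log_concave_on_def concave_on_iff convex_interior)
  have range: "0 < polar_integral f z \<and> polar_integral f z < \<infinity>" if "z \<in> ?S" for z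
    using polar_integral_pos_finite[OF log_concave finite_integral that] by blast
  have pos: "0 < ?p z" if "z \<in> ?S" for z
    using range[OF that] by (simp add: enn2real_positive_iff)
  have eq: "polar_integral f z = ennreal (?p z)" if "z \<in> ?S" for z
    using range[OF that] by (simp add: ennreal_enn2real)
  \<comment> \<open>Log-convexity in multiplicative form, from which both convexity claims follow.\<close>
  have geom: "?p (u *\<^sub>R a + v *\<^sub>R b) \<le> exp (u * ln (?p a) + v * ln (?p b))"
    if "a \<in> ?S" "b \<in> ?S" "0 \<le> u" "0 \<le> v" "u + v = 1" for a b u v
  proof -
    have laplace: "(\<integral>\<^sup>+ y. ennreal (exp (z \<bullet> y)) * log_polar f y \<partial>lborel) = polar_integral f z" for z
      using polar_integral_laplace[of f z] by simp
    have "polar_integral f (u *\<^sub>R a + v *\<^sub>R b) \<le> ennreal (exp (u * ln (?p a) + v * ln (?p b)))"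
      using laplace_log_convex[of "log_polar f" a "?p a" b "?p b" u v,
          OF borel_measurable_log_polar, unfolded laplace]
        eq[OF that(1)] eq[OF that(2)] pos[OF that(1)] pos[OF that(2)] that(3-5)
      by blast
    from enn2real_mono[OF this] show ?thesis by simp
  qed
  have ln_convex: "convex_on ?S (\<lambda>z. ln (?p z))"
    unfolding convex_on_def
  proof (intro conjI ballI allI impI conv)
    fix a b :: 'a and u v :: real
    assume ab: "a \<in> ?S" "b \<in> ?S" and uv: "0 \<le> u" "0 \<le> v" "u + v = 1"
    have "u *\<^sub>R a + v *\<^sub>R b \<in> ?S" using conv ab uv by (simp add: convex_def)
    from pos[OF this] geom[OF ab uv]
    show "ln (?p (u *\<^sub>R a + v *\<^sub>R b)) \<le> u * ln (?p a) + v * ln (?p b)"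
      by (metis exp_le_cancel_iff exp_ln)
  qed
  have "convex_on ?S ?p"
    unfolding convex_on_def
  proof (intro conjI ballI allI impI conv)
    fix a b :: 'a and u v :: real
    assume ab: "a \<in> ?S" "b \<in> ?S" and uv: "0 \<le> u" "0 \<le> v" "u + v = 1"
    have "exp (u * ln (?p a) + v * ln (?p b)) \<le> u * exp (ln (?p a)) + v * exp (ln (?p b))"
      using exp_convex uv unfolding convex_on_def by simp
    with geom[OF ab uv] pos[OF ab(1)] pos[OF ab(2)]
    show "?p (u *\<^sub>R a + v *\<^sub>R b) \<le> u * ?p a + v * ?p b" by simp
  qed
  moreover have "log_concave_on ?S (\<lambda>z. 1 / ?p z)"
    unfolding log_concave_on_def
  proof
    show "\<forall>z\<in>?S. 0 \<le> 1 / ?p z" by simp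
    have "?S \<inter> fun_supp (\<lambda>z. 1 / ?p z) = ?S" using pos by (auto simp: fun_supp_def)
    moreover have "concave_on ?S (\<lambda>z. ln (1 / ?p z))"
      using ln_convex by (simp add: concave_on_def divide_inverse ln_inverse)
    ultimately show "concave_on (?S \<inter> fun_supp (\<lambda>z. 1 / ?p z)) (\<lambda>z. ln (1 / ?p z))" by simp
  qed
  ultimately show ?thesis using range by blast
qed

end
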